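(* Let $R$ be a local ring. Then the following are equivalent: (1) $T_2(R)$ is perfectly clean. (2) $R$ is uniquely weakly bleached.
   Context: Rings are associative with identity, not necessarily commutative. $U(S)$ is the group of invertible elements of a ring $S$ and $J(S)$ its Jacobson radical. For $a\in S$, $comm(a)=\{x\in S\mid xa=ax\}$ and $comm^2(a)=\{x\in S\mid xy=yx \text{ for all } y\in comm(a)\}$. A ring $S$ is perfectly clean if for every $a\in S$ there is an idempotent $e\in comm^2(a)$ with $a-e\in U(S)$. A ring is local if it has only one maximal right ideal. $T_2(R)$ is the ring of $2\times 2$ upper triangular matrices over $R$. For $a,b\in R$, $l_a-r_b$ denotes the additive map $R\to R$, $x\mapsto ax-xb$. A ring $R$ is uniquely weakly bleached if for any $a\in J(R)$ and $b\in 1+J(R)$, the maps $l_a-r_b$ and $l_b-r_a$ are both isomorphisms (of the additive group of $R$). *)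

theory Defs
  imports "HOL-Algebra.Algebra"
begin

definition right_ideal :: "'a set \<Rightarrow> ('a, 'm) ring_scheme \<Rightarrow> bool" where
  "right_ideal I S \<longleftrightarrow> additive_subgroup I S \<and>
     (\<forall>x\<in>I. \<forall>r\<in>carrier S. x \<otimes>\<^bsub>S\<^esub> r \<in> I)"

definition maximal_right_ideal :: "'a set \<Rightarrow> ('a, 'm) ring_scheme \<Rightarrow> bool" where
  "maximal_right_ideal M S \<longleftrightarrow> right_ideal M S \<and> M \<noteq> carrier S \<and>
     (\<forall>I. right_ideal I S \<and> M \<subseteq> I \<longrightarrow> I = M \<or> I = carrier S)"

definition local_ring :: "('a, 'm) ring_scheme \<Rightarrow> bool" where
  "local_ring S \<longleftrightarrow> ring S \<and> (\<exists>!M. maximal_right_ideal M S)"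

(* Intersecting with the carrier gives J(S) = S when there are no maximal right ideals
   (the zero ring). *)
definition jacobson_radical :: "('a, 'm) ring_scheme \<Rightarrow> 'a set" where
  "jacobson_radical S = carrier S \<inter> \<Inter>{M. maximal_right_ideal M S}"

definition comm :: "('a, 'm) ring_scheme \<Rightarrow> 'a \<Rightarrow> 'a set" where
  "comm S a = {x \<in> carrier S. x \<otimes>\<^bsub>S\<^esub> a = a \<otimes>\<^bsub>S\<^esub> x}"

definition comm2 :: "('a, 'm) ring_scheme \<Rightarrow> 'a \<Rightarrow> 'a set" where
  "comm2 S a = {x \<in> carrier S. \<forall>y\<in>comm S a. x \<otimes>\<^bsub>S\<^esub> y = y \<otimes>\<^bsub>S\<^esub> x}"

definition perfectly_clean :: "('a, 'm) ring_scheme \<Rightarrow> bool" where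
  "perfectly_clean S \<longleftrightarrow> (\<forall>a\<in>carrier S. \<exists>e\<in>comm2 S a.
     e \<otimes>\<^bsub>S\<^esub> e = e \<and> a \<ominus>\<^bsub>S\<^esub> e \<in> Units S)"

definition uniquely_weakly_bleached :: "('a, 'm) ring_scheme \<Rightarrow> bool" where
  "uniquely_weakly_bleached R \<longleftrightarrow>
     (\<forall>a\<in>jacobson_radical R. \<forall>b\<in>{\<one>\<^bsub>R\<^esub> \<oplus>\<^bsub>R\<^esub> j | j. j \<in> jacobson_radical R}.
        (\<lambda>x. a \<otimes>\<^bsub>R\<^esub> x \<ominus>\<^bsub>R\<^esub> x \<otimes>\<^bsub>R\<^esub> b) \<in> iso (add_monoid R) (add_monoid R) \<and>
        (\<lambda>x. b \<otimes>\<^bsub>R\<^esub> x \<ominus>\<^bsub>R\<^esub> x \<otimes>\<^bsub>R\<^esub> a) \<in> iso (add_monoid R) (add_monoid R))"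

(* Mat2 a b c d is the matrix with rows (a, b) and (c, d). *)
datatype 'a mat2 = Mat2 (ent11: 'a) (ent12: 'a) (ent21: 'a) (ent22: 'a)

definition T2 :: "('a, 'm) ring_scheme \<Rightarrow> 'a mat2 ring" where
  "T2 R = \<lparr>
     carrier = {A. ent11 A \<in> carrier R \<and> ent12 A \<in> carrier R \<and>
                   ent21 A = \<zero>\<^bsub>R\<^esub> \<and> ent22 A \<in> carrier R},
     monoid.mult = (\<lambda>A B. Mat2
       (ent11 A \<otimes>\<^bsub>R\<^esub> ent11 B \<oplus>\<^bsub>R\<^esub> ent12 A \<otimes>\<^bsub>R\<^esub> ent21 B)
       (ent11 A \<otimes>\<^bsub>R\<^esub> ent12 B \<oplus>\<^bsub>R\<^esub> ent12 A \<otimes>\<^bsub>R\<^esub> ent22 B)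
       (ent21 A \<otimes>\<^bsub>R\<^esub> ent11 B \<oplus>\<^bsub>R\<^esub> ent22 A \<otimes>\<^bsub>R\<^esub> ent21 B)
       (ent21 A \<otimes>\<^bsub>R\<^esub> ent12 B \<oplus>\<^bsub>R\<^esub> ent22 A \<otimes>\<^bsub>R\<^esub> ent22 B)),
     one = Mat2 \<one>\<^bsub>R\<^esub> \<zero>\<^bsub>R\<^esub> \<zero>\<^bsub>R\<^esub> \<one>\<^bsub>R\<^esub>,
     ring.zero = Mat2 \<zero>\<^bsub>R\<^esub> \<zero>\<^bsub>R\<^esub> \<zero>\<^bsub>R\<^esub> \<zero>\<^bsub>R\<^esub>,
     ring.add = (\<lambda>A B. Mat2
       (ent11 A \<oplus>\<^bsub>R\<^esub> ent11 B) (ent12 A \<oplus>\<^bsub>R\<^esub> ent12 B)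
       (ent21 A \<oplus>\<^bsub>R\<^esub> ent21 B) (ent22 A \<oplus>\<^bsub>R\<^esub> ent22 B))\<rparr>"

lemma ring_T2:
  fixes R (structure)
  assumes "ring R"
  shows "ring (T2 R)"
proof -
  interpret ring R by fact
  have inv: "\<exists>B\<in>carrier (T2 R). B \<oplus>\<^bsub>T2 R\<^esub> A = \<zero>\<^bsub>T2 R\<^esub>" if "A \<in> carrier (T2 R)" for A
    using that
    by (intro bexI[of _ "Mat2 (\<ominus> ent11 A) (\<ominus> ent12 A) \<zero> (\<ominus> ent22 A)"])
       (auto simp: T2_def l_neg)
  show ?thesis
  proof (intro ringI abelian_groupI monoidI)
    fix A assume "A \<in> carrier (T2 R)"
    then show "\<exists>B\<in>carrier (T2 R). B \<oplus>\<^bsub>T2 R\<^esub> A = \<zero>\<^bsub>T2 R\<^esub>" by (rule inv)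
  qed (auto simp: T2_def mat2.expand l_distr r_distr m_assoc a_ac)
qed

end

theory Submission imports Defs begin

text \<open>
  In a local ring the Jacobson radical J is the set of non-units, so the only idempotents are 0
  and 1, and an upper triangular matrix is a unit iff its diagonal entries are. If a is in J and
  b in 1 + J, the idempotent E that makes A = (a, c; 0, b) clean is forced to have diagonal (1, 0),
  and its remaining entry f satisfies AE = EA iff a f - f b = c; that is surjectivity of
  \<open>l_a - r_b\<close>. Injectivity expresses that E commutes with the whole commutant of A: the kernel of
  \<open>l_a - r_b\<close> sits as strictly upper triangular matrices in the commutant of diag(a, b).
  Diagonals with a in 1 + J and b in J are treated alike, with 1 - E in place of E; for all other
  diagonals E = 0 or E = 1 already works.
\<close>

section \<open>Maximal right ideals, and the radical, units and idempotents of a local ring\<close>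

lemma (in ring) proper_right_ideal_subset_maximal:
  assumes I: "right_ideal I R" and "\<one> \<notin> I"
  shows "\<exists>M. maximal_right_ideal M R \<and> I \<subseteq> M"
proof -
  have whole: "K = carrier R" if K: "right_ideal K R" "\<one> \<in> K" for K
    using that additive_subgroup.a_subset[of K R] unfolding right_ideal_def
    by (metis l_one subsetI subset_antisym)
  \<comment> \<open>Properness is expressed as omitting \<open>\<one>\<close>, a condition that
    visibly survives unions of chains, so Zorn's lemma applies to \<open>F\<close>.\<close>
  define F where "F = {K. right_ideal K R \<and> I \<subseteq> K \<and> \<one> \<notin> K}"
  have "\<exists>U\<in>F. \<forall>K\<in>C. K \<subseteq> U" if C: "subset.chain F C" for C
  \<comment> \<open>The empty chain needs separate treatment: its union is empty and hence no right
    ideal, but \<open>I\<close> itself is a bound in \<open>F\<close>.\<close>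
  proof (cases "C = {}")
    case True
    with assms show ?thesis by (auto simp: F_def)
  next
    case False
    have CF: "C \<subseteq> F" and tot: "\<And>K L. K \<in> C \<Longrightarrow> L \<in> C \<Longrightarrow> K \<subseteq> L \<or> L \<subseteq> K"
      using C by (auto simp: subset.chain_def)
    have sub: "additive_subgroup K R" and mul: "\<And>x r. x \<in> K \<Longrightarrow> r \<in> carrier R \<Longrightarrow> x \<otimes> r \<in> K"
      if "K \<in> C" for K
      using that CF by (auto simp: F_def right_ideal_def)
    have "right_ideal (\<Union>C) R"
      unfolding right_ideal_def
    proof (intro conjI ballI)
      show "additive_subgroup (\<Union>C) R"
      proof (intro additive_subgroup.intro add.subgroupI)
        show "\<Union>C \<subseteq> carrier R"
          using sub additive_subgroup.a_subset by blast
        show "\<Union>C \<noteq> {}"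
          using False sub additive_subgroup.zero_closed by blast
        show "\<ominus> x \<in> \<Union>C" if x: "x \<in> \<Union>C" for x
        proof -
          obtain K where K: "K \<in> C" "x \<in> K" using x by blast
          then have "\<ominus> x \<in> K" using additive_subgroup.a_inv_closed[OF sub] by blast
          with K show ?thesis by blast
        qed
        show "x \<oplus> y \<in> \<Union>C" if xy: "x \<in> \<Union>C" "y \<in> \<Union>C" for x y
        proof -
          obtain K where "K \<in> C" "x \<in> K" "y \<in> K"
            using xy tot by blast
          then show ?thesis
            using additive_subgroup.a_closed[OF sub] by auto
        qed
      qed
    qed (use mul in blast)
    then have "\<Union>C \<in> F" using CF False by (auto simp: F_def)
    then show ?thesis by (intro bexI[of _ "\<Union>C"]) auto
  qed
  then have "\<exists>M\<in>F. \<forall>K\<in>F. M \<subseteq> K \<longrightarrow> K = M"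
    by (rule subset_Zorn)
  then obtain M where M: "M \<in> F" and max: "\<And>K. K \<in> F \<Longrightarrow> M \<subseteq> K \<Longrightarrow> K = M"
    by blast
  have "maximal_right_ideal M R"
    unfolding maximal_right_ideal_def
  proof (intro conjI allI impI)
    show "right_ideal M R" "M \<noteq> carrier R"
      using M by (auto simp: F_def)
    show "K = M \<or> K = carrier R" if "right_ideal K R \<and> M \<subseteq> K" for K
      using that max[of K] whole[of K] M by (auto simp: F_def)
  qed
  then show ?thesis using M by (auto simp: F_def)
qed

lemma (in ring) principal_right_ideal:
  assumes x: "x \<in> carrier R"
  shows "right_ideal ((\<lambda>r. x \<otimes> r) ` carrier R) R"
  unfolding right_ideal_def
proof (intro conjI ballI)
  show "additive_subgroup ((\<lambda>r. x \<otimes> r) ` carrier R) R"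
  proof (intro additive_subgroup.intro add.subgroupI)
    show "\<ominus> y \<in> (\<lambda>r. x \<otimes> r) ` carrier R" if "y \<in> (\<lambda>r. x \<otimes> r) ` carrier R" for y
      using that x by (auto simp: r_minus[symmetric])
    show "y \<oplus> z \<in> (\<lambda>r. x \<otimes> r) ` carrier R"
      if "y \<in> (\<lambda>r. x \<otimes> r) ` carrier R" "z \<in> (\<lambda>r. x \<otimes> r) ` carrier R" for y z
      using that x by (auto simp: r_distr[symmetric])
  qed (use x in auto)
qed (use x in \<open>auto simp: m_assoc\<close>)

text \<open>Uniqueness collapses the intersection that defines the radical to the single maximal
  right ideal, so the radical inherits all its properties.\<close>

lemma local_ring_maximal_right_ideal:
  assumes "local_ring R"
  shows "maximal_right_ideal (jacobson_radical R) R"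
proof -
  obtain M where M: "maximal_right_ideal M R" and uniq: "\<And>N. maximal_right_ideal N R \<Longrightarrow> N = M"
    using assms by (auto simp: local_ring_def)
  then have "{N. maximal_right_ideal N R} = {M}" by blast
  moreover have "M \<subseteq> carrier R"
    using M additive_subgroup.a_subset by (auto simp: maximal_right_ideal_def right_ideal_def)
  ultimately have "jacobson_radical R = M" by (auto simp: jacobson_radical_def)
  with M show ?thesis by simp
qed

lemma local_ring_one_notin_radical:
  assumes "local_ring R"
  shows "\<one>\<^bsub>R\<^esub> \<notin> jacobson_radical R"
proof
  interpret ring R using assms by (simp add: local_ring_def)
  assume "\<one>\<^bsub>R\<^esub> \<in> jacobson_radical R"
  then have "carrier R \<subseteq> jacobson_radical R"
    using local_ring_maximal_right_ideal[OF assms]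
    unfolding maximal_right_ideal_def right_ideal_def by (metis l_one subsetI)
  then show False
    using local_ring_maximal_right_ideal[OF assms]
    by (auto simp: maximal_right_ideal_def jacobson_radical_def)
qed

text \<open>Otherwise the right ideal xR omits 1 and lies in a maximal right ideal. That ideal can
  only be the radical, which would then contain x = x1.\<close>

lemma local_ring_right_inverse:
  fixes R (structure)
  assumes "local_ring R" "x \<in> carrier R" "x \<notin> jacobson_radical R"
  shows "\<exists>y\<in>carrier R. x \<otimes> y = \<one>"
proof (rule ccontr)
  interpret ring R using assms by (simp add: local_ring_def)
  assume "\<not> ?thesis"
  then have "\<one> \<notin> (\<lambda>r. x \<otimes> r) ` carrier R" by force
  then obtain M where M: "maximal_right_ideal M R" "(\<lambda>r. x \<otimes> r) ` carrier R \<subseteq> M"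
    using proper_right_ideal_subset_maximal principal_right_ideal assms(2) by blast
  then have "M = jacobson_radical R"
    using local_ring_maximal_right_ideal[OF assms(1)] assms(1) by (auto simp: local_ring_def)
  moreover have "x \<otimes> \<one> \<in> M" using M(2) by blast
  ultimately show False using assms by simp
qed

lemma local_ring_additive_subgroup:
  "local_ring R \<Longrightarrow> additive_subgroup (jacobson_radical R) R"
  using local_ring_maximal_right_ideal[of R] by (simp add: maximal_right_ideal_def right_ideal_def)

lemma local_ring_one_minus_notin_radical:
  fixes R (structure)
  assumes R: "local_ring R" and x: "x \<in> jacobson_radical R"
  shows "\<one> \<ominus> x \<notin> jacobson_radical R"
proof
  interpret ring R using R by (simp add: local_ring_def)
  interpret J: additive_subgroup "jacobson_radical R" R
    by (rule local_ring_additive_subgroup[OF R])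
  have c: "x \<in> carrier R" using x J.a_subset by blast
  assume "\<one> \<ominus> x \<in> jacobson_radical R"
  then have "(\<one> \<ominus> x) \<oplus> x \<in> jacobson_radical R" using x by simp
  then show False
    using local_ring_one_notin_radical[OF R] c by (simp add: a_minus_def a_assoc l_neg)
qed

text \<open>Right ideals supply only right inverses. They become two-sided because a right inverse y
  of x again lies outside the radical, so y has a right inverse of its own.\<close>

lemma local_ring_Units:
  fixes R (structure)
  assumes R: "local_ring R"
  shows "Units R = carrier R - jacobson_radical R"
proof
  interpret ring R using R by (simp add: local_ring_def)
  let ?J = "jacobson_radical R"
  have mul: "x \<otimes> r \<in> ?J" if "x \<in> ?J" "r \<in> carrier R" for x r
    using that local_ring_maximal_right_ideal[OF R]
    by (auto simp: maximal_right_ideal_def right_ideal_def)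
  show "Units R \<subseteq> carrier R - ?J"
    using mul local_ring_one_notin_radical[OF R] by (force simp: Units_def)
  show "carrier R - ?J \<subseteq> Units R"
  proof
    fix x assume "x \<in> carrier R - ?J"
    then have x: "x \<in> carrier R" "x \<notin> ?J" by auto
    obtain y where y: "y \<in> carrier R" "x \<otimes> y = \<one>"
      using local_ring_right_inverse[OF R x] by blast
    \<comment> \<open>If y were in the radical, so would be yx, and 1 - yx would have a right
      inverse u. But x(1 - yx) = x - (xy)x = 0, and multiplying by u gives x = 0, which lies in the
      radical.\<close>
    have "y \<notin> ?J"
    proof
      assume "y \<in> ?J"
      then have "\<one> \<ominus> y \<otimes> x \<notin> ?J"
        using mul x(1) local_ring_one_minus_notin_radical[OF R] by blast
      then obtain u where u: "u \<in> carrier R" "(\<one> \<ominus> y \<otimes> x) \<otimes> u = \<one>"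
        using local_ring_right_inverse[OF R, of "\<one> \<ominus> y \<otimes> x"] x(1) y(1) by blast
      have "x \<otimes> (\<one> \<ominus> y \<otimes> x) = \<zero>"
        using x y by (simp add: a_minus_def r_distr r_minus m_assoc[symmetric] r_neg)
      moreover have "x \<otimes> (\<one> \<ominus> y \<otimes> x) \<otimes> u = x \<otimes> ((\<one> \<ominus> y \<otimes> x) \<otimes> u)"
        using x y u by (intro m_assoc) auto
      ultimately have "x = \<zero>" using u x by simp
      then show False
        using x(2) additive_subgroup.zero_closed[OF local_ring_additive_subgroup[OF R]] by simp
    qed
    then obtain z where z: "z \<in> carrier R" "y \<otimes> z = \<one>"
      using local_ring_right_inverse[OF R] y by blast
    \<comment> \<open>The left inverse x and the right inverse z of y must agree.\<close>
    then have "z = x" using inv_unique[of x y z] x y by simp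
    then show "x \<in> Units R" using x y z by (auto simp: Units_def)
  qed
qed

text \<open>One of e and 1 - e is a unit, and it can be cancelled from (1 - e)e = 0 or from ee =
  e.\<close>

lemma local_ring_idempotent:
  fixes R (structure)
  assumes R: "local_ring R" and e: "e \<in> carrier R" "e \<otimes> e = e"
  shows "e = \<zero> \<or> e = \<one>"
proof (cases "e \<in> jacobson_radical R")
  interpret ring R using R by (simp add: local_ring_def)
  case True
  then have u: "\<one> \<ominus> e \<in> Units R"
    using local_ring_one_minus_notin_radical[OF R] local_ring_Units[OF R] e by auto
  have "(\<one> \<ominus> e) \<otimes> e = (\<one> \<ominus> e) \<otimes> \<zero>"
    using e by (simp add: a_minus_def l_distr l_minus r_neg)
  then show ?thesis using Units_l_cancel[OF u] e by blast
next
  interpret ring R using R by (simp add: local_ring_def)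
  case False
  then have "e \<in> Units R" using e local_ring_Units[OF R] by blast
  then show ?thesis using Units_l_cancel[of e e \<one>] e by simp
qed

section \<open>Entrywise arithmetic and units of upper triangular matrices\<close>

lemma T2_simps:
  "Mat2 a b c d \<in> carrier (T2 R) \<longleftrightarrow>
     a \<in> carrier R \<and> b \<in> carrier R \<and> c = \<zero>\<^bsub>R\<^esub> \<and> d \<in> carrier R"
  "Mat2 a b c d \<otimes>\<^bsub>T2 R\<^esub> Mat2 a' b' c' d' = Mat2
     (a \<otimes>\<^bsub>R\<^esub> a' \<oplus>\<^bsub>R\<^esub> b \<otimes>\<^bsub>R\<^esub> c') (a \<otimes>\<^bsub>R\<^esub> b' \<oplus>\<^bsub>R\<^esub> b \<otimes>\<^bsub>R\<^esub> d')
     (c \<otimes>\<^bsub>R\<^esub> a' \<oplus>\<^bsub>R\<^esub> d \<otimes>\<^bsub>R\<^esub> c') (c \<otimes>\<^bsub>R\<^esub> b' \<oplus>\<^bsub>R\<^esub> d \<otimes>\<^bsub>R\<^esub> d')"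
  "Mat2 a b c d \<oplus>\<^bsub>T2 R\<^esub> Mat2 a' b' c' d' =
     Mat2 (a \<oplus>\<^bsub>R\<^esub> a') (b \<oplus>\<^bsub>R\<^esub> b') (c \<oplus>\<^bsub>R\<^esub> c') (d \<oplus>\<^bsub>R\<^esub> d')"
  "\<one>\<^bsub>T2 R\<^esub> = Mat2 \<one>\<^bsub>R\<^esub> \<zero>\<^bsub>R\<^esub> \<zero>\<^bsub>R\<^esub> \<one>\<^bsub>R\<^esub>"
  "\<zero>\<^bsub>T2 R\<^esub> = Mat2 \<zero>\<^bsub>R\<^esub> \<zero>\<^bsub>R\<^esub> \<zero>\<^bsub>R\<^esub> \<zero>\<^bsub>R\<^esub>"
  by (auto simp: T2_def)

lemma T2_cases:
  assumes "A \<in> carrier (T2 R)"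
  obtains a b d where "A = Mat2 a b \<zero>\<^bsub>R\<^esub> d" "a \<in> carrier R" "b \<in> carrier R" "d \<in> carrier R"
  using assms by (cases A) (auto simp: T2_simps)

context ring
begin

lemma T2_minus:
  assumes "a \<in> carrier R" "b \<in> carrier R" "d \<in> carrier R"
    "a' \<in> carrier R" "b' \<in> carrier R" "d' \<in> carrier R"
  shows "Mat2 a b \<zero> d \<ominus>\<^bsub>T2 R\<^esub> Mat2 a' b' \<zero> d' = Mat2 (a \<ominus> a') (b \<ominus> b') \<zero> (d \<ominus> d')"
proof -
  interpret T: ring "T2 R" by (rule ring_T2) (rule ring_axioms)
  have "\<ominus>\<^bsub>T2 R\<^esub> Mat2 a' b' \<zero> d' = Mat2 (\<ominus> a') (\<ominus> b') \<zero> (\<ominus> d')"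
    by (rule T.minus_equality) (use assms in \<open>auto simp: T2_simps l_neg\<close>)
  with assms show ?thesis
    by (simp add: a_minus_def[of "T2 R"] a_minus_def[of R] T2_simps)
qed

text \<open>The diagonal of a product of triangular matrices is the product of the diagonals, which
  gives one direction. For the other, the inverse can be written down.\<close>

lemma T2_Units:
  assumes "a \<in> carrier R" "b \<in> carrier R" "d \<in> carrier R"
  shows "Mat2 a b \<zero> d \<in> Units (T2 R) \<longleftrightarrow> a \<in> Units R \<and> d \<in> Units R"
proof
  interpret T: ring "T2 R" by (rule ring_T2) (rule ring_axioms)
  assume "Mat2 a b \<zero> d \<in> Units (T2 R)"
  then obtain B where "B \<in> carrier (T2 R)"
    "B \<otimes>\<^bsub>T2 R\<^esub> Mat2 a b \<zero> d = \<one>\<^bsub>T2 R\<^esub>" "Mat2 a b \<zero> d \<otimes>\<^bsub>T2 R\<^esub> B = \<one>\<^bsub>T2 R\<^esub>"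
    by (auto simp: Units_def)
  then show "a \<in> Units R \<and> d \<in> Units R"
    by (auto elim!: T2_cases simp: T2_simps Units_def assms)
next
  assume u: "a \<in> Units R \<and> d \<in> Units R"
  \<comment> \<open>The upper right entry is the solution y of ay + b d^{-1} = 0, as the upper right
    entry of the product with \<open>B\<close> demands.\<close>
  define B where "B = Mat2 (inv a) (\<ominus> (inv a \<otimes> b \<otimes> inv d)) \<zero> (inv d)"
  have "inv a \<otimes> b \<oplus> \<ominus> (inv a \<otimes> b \<otimes> inv d) \<otimes> d = \<zero>"
    "a \<otimes> \<ominus> (inv a \<otimes> b \<otimes> inv d) \<oplus> b \<otimes> inv d = \<zero>"
    using u assms
    by (simp_all add: l_minus r_minus m_assoc r_neg l_neg) (simp add: m_assoc[symmetric] l_neg)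
  with u assms have "B \<in> carrier (T2 R)" "B \<otimes>\<^bsub>T2 R\<^esub> Mat2 a b \<zero> d = \<one>\<^bsub>T2 R\<^esub>"
    "Mat2 a b \<zero> d \<otimes>\<^bsub>T2 R\<^esub> B = \<one>\<^bsub>T2 R\<^esub>"
    by (auto simp: B_def T2_simps)
  then show "Mat2 a b \<zero> d \<in> Units (T2 R)"
    using assms by (auto simp: Units_def T2_simps)
qed

section \<open>The additive map l_a - r_b and double commutants of triangular matrices\<close>

lemma sylvester_hom:
  assumes "a \<in> carrier R" "b \<in> carrier R"
  shows "(\<lambda>x. a \<otimes> x \<ominus> x \<otimes> b) \<in> hom (add_monoid R) (add_monoid R)"
proof (rule homI)
  fix x y assume "x \<in> carrier (add_monoid R)" "y \<in> carrier (add_monoid R)"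
  then have xy: "x \<in> carrier R" "y \<in> carrier R" by simp_all
  then have "a \<otimes> (x \<oplus> y) \<ominus> (x \<oplus> y) \<otimes> b = (a \<otimes> x \<oplus> a \<otimes> y) \<oplus> (\<ominus> (x \<otimes> b) \<oplus> \<ominus> (y \<otimes> b))"
    using assms by (simp add: a_minus_def l_distr r_distr minus_add)
  also have "\<dots> = (a \<otimes> x \<ominus> x \<otimes> b) \<oplus> (a \<otimes> y \<ominus> y \<otimes> b)"
    using assms xy by (simp add: a_minus_def a_ac)
  finally show "a \<otimes> (x \<otimes>\<^bsub>add_monoid R\<^esub> y) \<ominus> (x \<otimes>\<^bsub>add_monoid R\<^esub> y) \<otimes> b =
      (a \<otimes> x \<ominus> x \<otimes> b) \<otimes>\<^bsub>add_monoid R\<^esub> (a \<otimes> y \<ominus> y \<otimes> b)"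
    by simp
qed (use assms in simp)

text \<open>An additive endomorphism is bijective iff its kernel is trivial and it is onto. The
  kernel is written as ax = xb because this equation is what a commutation of matrices
  produces.\<close>

lemma sylvester_iso_iff:
  assumes ab: "a \<in> carrier R" "b \<in> carrier R"
  shows "(\<lambda>x. a \<otimes> x \<ominus> x \<otimes> b) \<in> iso (add_monoid R) (add_monoid R) \<longleftrightarrow>
    (\<forall>x\<in>carrier R. a \<otimes> x = x \<otimes> b \<longrightarrow> x = \<zero>) \<and>
    (\<forall>c\<in>carrier R. \<exists>x\<in>carrier R. a \<otimes> x \<ominus> x \<otimes> b = c)"
proof -
  interpret f: group_hom "add_monoid R" "add_monoid R" "\<lambda>x. a \<otimes> x \<ominus> x \<otimes> b"
    using sylvester_hom[OF ab]
    by (intro group_hom.intro group_hom_axioms.intro) (rule add.is_group | assumption)+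
  have "inj_on (\<lambda>x. a \<otimes> x \<ominus> x \<otimes> b) (carrier R) \<longleftrightarrow>
      (\<forall>x\<in>carrier R. a \<otimes> x = x \<otimes> b \<longrightarrow> x = \<zero>)"
    using f.inj_on_one_iff ab by (auto simp: r_right_minus_eq)
  moreover have "(\<lambda>x. a \<otimes> x \<ominus> x \<otimes> b) ` carrier R = carrier R \<longleftrightarrow>
      (\<forall>c\<in>carrier R. \<exists>x\<in>carrier R. a \<otimes> x \<ominus> x \<otimes> b = c)"
    (is "?lhs \<longleftrightarrow> ?rhs")
  proof
    show ?rhs if ?lhs
      using that by (metis (no_types, lifting) imageE)
    show ?lhs if ?rhs
    proof
      show "carrier R \<subseteq> (\<lambda>x. a \<otimes> x \<ominus> x \<otimes> b) ` carrier R"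
      proof
        fix c assume "c \<in> carrier R"
        with that obtain x where "x \<in> carrier R" "c = a \<otimes> x \<ominus> x \<otimes> b" by metis
        then show "c \<in> (\<lambda>x. a \<otimes> x \<ominus> x \<otimes> b) ` carrier R" by blast
      qed
    qed (use ab in auto)
  qed
  ultimately show ?thesis
    using sylvester_hom[OF ab] by (auto simp: iso_def bij_betw_def)
qed

text \<open>Passing to the complement exchanges idempotents of diagonal (0, 1) with those of
  diagonal (1, 0), so only the latter need a detailed analysis.\<close>

lemma comm2_one_minus:
  assumes "e \<in> comm2 R a"
  shows "\<one> \<ominus> e \<in> comm2 R a"
  unfolding comm2_def
proof (intro CollectI conjI ballI)
  have e: "e \<in> carrier R" using assms by (simp add: comm2_def)
  then show "\<one> \<ominus> e \<in> carrier R" by simp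
  fix y assume "y \<in> comm R a"
  then have "y \<in> carrier R" "e \<otimes> y = y \<otimes> e"
    using assms by (simp_all add: comm2_def comm_def)
  with e show "(\<one> \<ominus> e) \<otimes> y = y \<otimes> (\<one> \<ominus> e)"
    by (simp add: a_minus_def l_distr r_distr l_minus r_minus)
qed

text \<open>Write E for the idempotent and A for the other matrix. Commuting with A amounts to the
  equation for c. For Y in the commutant of A, the only possibly nonzero entry of EY - YE lies in
  the kernel of l_a - r_d, so a trivial kernel makes E commute with Y.\<close>

lemma T2_upper_idempotent_in_comm2_iff:
  assumes c: "a \<in> carrier R" "c \<in> carrier R" "d \<in> carrier R" "f \<in> carrier R"
  shows "Mat2 \<one> f \<zero> \<zero> \<in> comm2 (T2 R) (Mat2 a c \<zero> d) \<longleftrightarrow>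
    a \<otimes> f \<ominus> f \<otimes> d = c \<and> (\<forall>x\<in>carrier R. a \<otimes> x = x \<otimes> d \<longrightarrow> x = \<zero>)"
    (is "?E \<in> comm2 _ ?A \<longleftrightarrow> _")
proof (intro iffI conjI ballI impI)
  assume E: "?E \<in> comm2 (T2 R) ?A"
  have "?A \<in> comm (T2 R) ?A" using c by (simp add: comm_def T2_simps)
  then have "?E \<otimes>\<^bsub>T2 R\<^esub> ?A = ?A \<otimes>\<^bsub>T2 R\<^esub> ?E" using E by (simp add: comm2_def)
  then have "a \<otimes> f = c \<oplus> f \<otimes> d" using c by (simp add: T2_simps)
  then show "a \<otimes> f \<ominus> f \<otimes> d = c" using c by (simp add: a_minus_def a_assoc r_neg)
  fix x assume x: "x \<in> carrier R" "a \<otimes> x = x \<otimes> d"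
  \<comment> \<open>A kernel element x gives a strictly upper triangular N commuting with A. Since
    EN = N while NE = 0, commutation of E with N forces x = 0.\<close>
  then have "Mat2 \<zero> x \<zero> \<zero> \<in> comm (T2 R) ?A" using c by (simp add: comm_def T2_simps)
  then have "?E \<otimes>\<^bsub>T2 R\<^esub> Mat2 \<zero> x \<zero> \<zero> = Mat2 \<zero> x \<zero> \<zero> \<otimes>\<^bsub>T2 R\<^esub> ?E"
    using E by (simp add: comm2_def)
  then show "x = \<zero>" using c x by (simp add: T2_simps)
next
  assume *: "a \<otimes> f \<ominus> f \<otimes> d = c \<and> (\<forall>x\<in>carrier R. a \<otimes> x = x \<otimes> d \<longrightarrow> x = \<zero>)"
  then have inj: "\<And>x. x \<in> carrier R \<Longrightarrow> a \<otimes> x = x \<otimes> d \<Longrightarrow> x = \<zero>" by blast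
  have af: "a \<otimes> f = c \<oplus> f \<otimes> d"
    using * c by (auto simp: a_minus_def a_assoc l_neg)
  show "?E \<in> comm2 (T2 R) ?A"
    unfolding comm2_def
  proof (intro CollectI conjI ballI)
    show "?E \<in> carrier (T2 R)" using c by (simp add: T2_simps)
    fix Y assume Y: "Y \<in> comm (T2 R) ?A"
    then obtain p q r where Yc: "Y = Mat2 p q \<zero> r" "p \<in> carrier R" "q \<in> carrier R" "r \<in> carrier R"
      by (auto simp: comm_def elim: T2_cases)
    have comm: "p \<otimes> a = a \<otimes> p" "r \<otimes> d = d \<otimes> r" "p \<otimes> c \<oplus> q \<otimes> d = a \<otimes> q \<oplus> c \<otimes> r"
      using Y c Yc by (simp_all add: comm_def T2_simps)
    \<comment> \<open>This is the upper right entry of EY - YE. The calculation below shows ax =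
      xd.\<close>
    define x where "x = q \<oplus> f \<otimes> r \<ominus> p \<otimes> f"
    \<comment> \<open>Used with u = pc, the term common to both sides of the difference once af is
      replaced by c + fd and aq + cr by pc + qd.\<close>
    have cancel: "u \<oplus> v \<oplus> w \<ominus> (u \<oplus> z) = v \<oplus> w \<ominus> z"
      if "u \<in> carrier R" "v \<in> carrier R" "w \<in> carrier R" "z \<in> carrier R" for u v w z
    proof -
      have "u \<oplus> v \<oplus> w \<ominus> (u \<oplus> z) = (u \<oplus> \<ominus> u) \<oplus> (v \<oplus> w \<ominus> z)"
        using that unfolding a_minus_def by (simp only: minus_add a_ac a_closed a_inv_closed)
      then show ?thesis using that by (simp add: r_neg)
    qed
    have "a \<otimes> x = a \<otimes> q \<oplus> a \<otimes> f \<otimes> r \<ominus> a \<otimes> p \<otimes> f"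
      using c Yc by (simp add: x_def a_minus_def r_distr r_minus m_assoc)
    also have "a \<otimes> p \<otimes> f = p \<otimes> (a \<otimes> f)"
      using c Yc comm(1) by (simp add: m_assoc[symmetric])
    also have "a \<otimes> q \<oplus> a \<otimes> f \<otimes> r = (a \<otimes> q \<oplus> c \<otimes> r) \<oplus> f \<otimes> (d \<otimes> r)"
      using c Yc by (simp add: af l_distr m_assoc a_assoc)
    also have "\<dots> \<ominus> p \<otimes> (a \<otimes> f) = q \<otimes> d \<oplus> f \<otimes> (d \<otimes> r) \<ominus> p \<otimes> (f \<otimes> d)"
      using c Yc cancel by (simp add: af r_distr comm(3)[symmetric])
    also have "\<dots> = x \<otimes> d"
      using c Yc by (simp add: x_def a_minus_def l_distr l_minus m_assoc comm(2))
    finally have "x = \<zero>" using inj c Yc by (simp add: x_def)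
    then have "q \<oplus> f \<otimes> r = p \<otimes> f" using c Yc by (simp add: x_def)
    then show "?E \<otimes>\<^bsub>T2 R\<^esub> Y = Y \<otimes>\<^bsub>T2 R\<^esub> ?E" using c Yc by (simp add: T2_simps)
  qed
qed

text \<open>Solvability for each c is surjectivity, and the second condition on the idempotent is
  injectivity. This translates bleachedness into statements about double commutants in
  \<open>T2 R\<close>.\<close>

lemma sylvester_iso_iff_comm2:
  assumes "a \<in> carrier R" "d \<in> carrier R"
  shows "(\<lambda>x. a \<otimes> x \<ominus> x \<otimes> d) \<in> iso (add_monoid R) (add_monoid R) \<longleftrightarrow>
    (\<forall>c\<in>carrier R. \<exists>f\<in>carrier R. Mat2 \<one> f \<zero> \<zero> \<in> comm2 (T2 R) (Mat2 a c \<zero> d))"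
proof -
  have *: "Mat2 \<one> f \<zero> \<zero> \<in> comm2 (T2 R) (Mat2 a c \<zero> d) \<longleftrightarrow>
    a \<otimes> f \<ominus> f \<otimes> d = c \<and> (\<forall>x\<in>carrier R. a \<otimes> x = x \<otimes> d \<longrightarrow> x = \<zero>)"
    if "c \<in> carrier R" "f \<in> carrier R" for c f
    using that assms by (intro T2_upper_idempotent_in_comm2_iff)
  show ?thesis
    unfolding sylvester_iso_iff[OF assms]
  proof (intro iffI conjI)
    assume "\<forall>c\<in>carrier R. \<exists>f\<in>carrier R. Mat2 \<one> f \<zero> \<zero> \<in> comm2 (T2 R) (Mat2 a c \<zero> d)"
    then have ex: "\<exists>f\<in>carrier R. a \<otimes> f \<ominus> f \<otimes> d = c \<and> (\<forall>x\<in>carrier R. a \<otimes> x = x \<otimes> d \<longrightarrow> x = \<zero>)"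
      if "c \<in> carrier R" for c
      using that * by meson
    \<comment> \<open>The kernel condition does not mention c, so the single value c = 0 already
      yields it.\<close>
    show "\<forall>x\<in>carrier R. a \<otimes> x = x \<otimes> d \<longrightarrow> x = \<zero>"
      using ex[OF zero_closed] by (elim bexE conjE)
    show "\<forall>c\<in>carrier R. \<exists>f\<in>carrier R. a \<otimes> f \<ominus> f \<otimes> d = c"
      using ex by meson
  qed (use * in meson)
qed

end

section \<open>Bleachedness of a local ring in terms of units and idempotent matrices\<close>

lemma local_ring_one_plus_radical:
  fixes R (structure)
  assumes R: "local_ring R"
  shows "{\<one> \<oplus> j | j. j \<in> jacobson_radical R} =
    {b \<in> carrier R. b \<ominus> \<one> \<notin> Units R}"
proof -
  interpret ring R using R by (simp add: local_ring_def)
  have sub: "jacobson_radical R \<subseteq> carrier R" by (auto simp: jacobson_radical_def)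
  have "\<one> \<oplus> j \<ominus> \<one> = j" if "j \<in> carrier R" for j
    using that by (simp add: a_minus_def a_ac r_neg1) (simp add: a_ac r_neg)
  moreover have "b = \<one> \<oplus> (b \<ominus> \<one>)" if "b \<in> carrier R" for b
    using that by (simp add: a_minus_def a_lcomm r_neg)
  ultimately show ?thesis
    using sub local_ring_Units[OF R] by (auto; blast)
qed

text \<open>The diagonal of the equation says that e and g are idempotents of a local ring, hence
  trivial.\<close>

lemma local_ring_T2_idempotent_diagonal:
  assumes R: "local_ring R" and E: "Mat2 e f \<zero>\<^bsub>R\<^esub> g \<in> carrier (T2 R)"
    "Mat2 e f \<zero>\<^bsub>R\<^esub> g \<otimes>\<^bsub>T2 R\<^esub> Mat2 e f \<zero>\<^bsub>R\<^esub> g = Mat2 e f \<zero>\<^bsub>R\<^esub> g"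
  shows "e \<in> {\<zero>\<^bsub>R\<^esub>, \<one>\<^bsub>R\<^esub>}" "g \<in> {\<zero>\<^bsub>R\<^esub>, \<one>\<^bsub>R\<^esub>}"
proof -
  interpret ring R using R by (simp add: local_ring_def)
  have "e \<in> carrier R" "g \<in> carrier R" "e \<otimes>\<^bsub>R\<^esub> e = e" "g \<otimes>\<^bsub>R\<^esub> g = g"
    using E by (simp_all add: T2_simps)
  then show "e \<in> {\<zero>\<^bsub>R\<^esub>, \<one>\<^bsub>R\<^esub>}" "g \<in> {\<zero>\<^bsub>R\<^esub>, \<one>\<^bsub>R\<^esub>}"
    using local_ring_idempotent[OF R] by blast+
qed

text \<open>Membership in the radical and in its translate by 1 becomes a statement about non-units,
  and the two isomorphisms become the two orders of the diagonal. Both directions of the equivalence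
  work from this form.\<close>

lemma local_ring_uniquely_weakly_bleached_iff:
  fixes R (structure)
  assumes R: "local_ring R"
  shows "uniquely_weakly_bleached R \<longleftrightarrow>
    (\<forall>a\<in>carrier R - Units R. \<forall>b\<in>carrier R. b \<ominus> \<one> \<notin> Units R \<longrightarrow>
      (\<forall>c\<in>carrier R. \<exists>f\<in>carrier R. Mat2 \<one> f \<zero> \<zero> \<in> comm2 (T2 R) (Mat2 a c \<zero> b)) \<and>
      (\<forall>c\<in>carrier R. \<exists>f\<in>carrier R. Mat2 \<one> f \<zero> \<zero> \<in> comm2 (T2 R) (Mat2 b c \<zero> a)))"
proof -
  interpret ring R using R by (simp add: local_ring_def)
  have "jacobson_radical R = carrier R - Units R"
    using local_ring_Units[OF R] by (auto simp: jacobson_radical_def)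
  then show ?thesis
    unfolding uniquely_weakly_bleached_def local_ring_one_plus_radical[OF R]
    by (auto simp: sylvester_iso_iff_comm2)
qed

section \<open>Matching clean idempotents with the possible diagonals\<close>

theorem corollary3p6:
  fixes R :: "('a, 'm) ring_scheme"
  assumes "local_ring R"
  shows "perfectly_clean (T2 R) \<longleftrightarrow> uniquely_weakly_bleached R"
proof -
  interpret ring R using assms by (simp add: local_ring_def)
  interpret T: ring "T2 R" by (rule ring_T2) (rule ring_axioms)
  let ?E = "\<lambda>f. Mat2 \<one>\<^bsub>R\<^esub> f \<zero>\<^bsub>R\<^esub> \<zero>\<^bsub>R\<^esub>"
  have compl: "\<one>\<^bsub>T2 R\<^esub> \<ominus>\<^bsub>T2 R\<^esub> Mat2 e f \<zero>\<^bsub>R\<^esub> g =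
      Mat2 (\<one>\<^bsub>R\<^esub> \<ominus>\<^bsub>R\<^esub> e) (\<ominus>\<^bsub>R\<^esub> f) \<zero>\<^bsub>R\<^esub> (\<one>\<^bsub>R\<^esub> \<ominus>\<^bsub>R\<^esub> g)"
    if "e \<in> carrier R" "f \<in> carrier R" "g \<in> carrier R" for e f g
    using that by (simp add: T2_simps T2_minus) (simp add: a_minus_def)
  have r0: "x \<ominus>\<^bsub>R\<^esub> \<zero>\<^bsub>R\<^esub> = x" "x \<ominus>\<^bsub>R\<^esub> x = \<zero>\<^bsub>R\<^esub>" if "x \<in> carrier R" for x
    using that by (simp_all add: a_minus_def r_neg)
  show ?thesis
  proof
    assume pc: "perfectly_clean (T2 R)"
    \<comment> \<open>Cleanness read off entrywise: idempotency makes the diagonal of E trivial, and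
      the unit condition splits over the diagonal.\<close>
    have clean: "\<exists>e f g. Mat2 e f \<zero>\<^bsub>R\<^esub> g \<in> comm2 (T2 R) (Mat2 a c \<zero>\<^bsub>R\<^esub> d) \<and>
        f \<in> carrier R \<and> e \<in> {\<zero>\<^bsub>R\<^esub>, \<one>\<^bsub>R\<^esub>} \<and> g \<in> {\<zero>\<^bsub>R\<^esub>, \<one>\<^bsub>R\<^esub>} \<and>
        a \<ominus>\<^bsub>R\<^esub> e \<in> Units R \<and> d \<ominus>\<^bsub>R\<^esub> g \<in> Units R"
      if acd: "a \<in> carrier R" "c \<in> carrier R" "d \<in> carrier R" for a c d
    proof -
      obtain E where E: "E \<in> comm2 (T2 R) (Mat2 a c \<zero>\<^bsub>R\<^esub> d)" "E \<otimes>\<^bsub>T2 R\<^esub> E = E"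
        "Mat2 a c \<zero>\<^bsub>R\<^esub> d \<ominus>\<^bsub>T2 R\<^esub> E \<in> Units (T2 R)"
        using pc acd unfolding perfectly_clean_def by (metis T2_simps(1))
      have Ec: "E \<in> carrier (T2 R)" using E(1) by (simp add: comm2_def)
      then obtain e f g where efg: "E = Mat2 e f \<zero>\<^bsub>R\<^esub> g"
        "e \<in> carrier R" "f \<in> carrier R" "g \<in> carrier R" by (rule T2_cases)
      have "e \<in> {\<zero>\<^bsub>R\<^esub>, \<one>\<^bsub>R\<^esub>}" "g \<in> {\<zero>\<^bsub>R\<^esub>, \<one>\<^bsub>R\<^esub>}"
        using local_ring_T2_idempotent_diagonal[OF assms] Ec E(2) unfolding efg(1) by blast+
      moreover have "a \<ominus>\<^bsub>R\<^esub> e \<in> Units R" "d \<ominus>\<^bsub>R\<^esub> g \<in> Units R"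
        using E(3) acd efg by (simp_all add: T2_minus T2_Units)
      ultimately show ?thesis using E(1) efg by blast
    qed
    show "uniquely_weakly_bleached R"
      unfolding local_ring_uniquely_weakly_bleached_iff[OF assms]
    proof (intro ballI impI conjI)
      fix a b c
      assume a: "a \<in> carrier R - Units R" and b: "b \<in> carrier R" "b \<ominus>\<^bsub>R\<^esub> \<one>\<^bsub>R\<^esub> \<notin> Units R"
        and c: "c \<in> carrier R"
      \<comment> \<open>As a is not a unit, e = 0 is excluded; as b - 1 is not a unit, g = 1 is
        excluded. Only the diagonal (1, 0) remains.\<close>
      show "\<exists>f\<in>carrier R. ?E f \<in> comm2 (T2 R) (Mat2 a c \<zero>\<^bsub>R\<^esub> b)"
        using clean[of a c b] a b c r0(1)[of a] by auto
      \<comment> \<open>With the entries exchanged the diagonal is forced to be (0, 1), and the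
        complement brings it back to (1, 0).\<close>
      obtain f where f: "f \<in> carrier R"
        "Mat2 \<zero>\<^bsub>R\<^esub> f \<zero>\<^bsub>R\<^esub> \<one>\<^bsub>R\<^esub> \<in> comm2 (T2 R) (Mat2 b c \<zero>\<^bsub>R\<^esub> a)"
        using clean[of b c a] a b c r0(1)[of a] by auto
      then have "?E (\<ominus>\<^bsub>R\<^esub> f) \<in> comm2 (T2 R) (Mat2 b c \<zero>\<^bsub>R\<^esub> a)"
        using T.comm2_one_minus[OF f(2)] by (simp add: compl r0)
      then show "\<exists>f\<in>carrier R. ?E f \<in> comm2 (T2 R) (Mat2 b c \<zero>\<^bsub>R\<^esub> a)"
        using f(1) by blast
    qed
  next
    assume wb: "uniquely_weakly_bleached R"
    have one_minus: "a \<ominus>\<^bsub>R\<^esub> \<one>\<^bsub>R\<^esub> \<in> Units R" if "a \<in> carrier R" "a \<notin> Units R" for a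
    proof -
      have "\<one>\<^bsub>R\<^esub> \<ominus>\<^bsub>R\<^esub> a \<in> Units R"
        using local_ring_one_minus_notin_radical[OF assms, of a] local_ring_Units[OF assms] that
        by auto
      \<comment> \<open>Units are closed under multiplication by -1, which turns 1 - a into a -
        1.\<close>
      then have "\<ominus>\<^bsub>R\<^esub> \<one>\<^bsub>R\<^esub> \<otimes>\<^bsub>R\<^esub> (\<one>\<^bsub>R\<^esub> \<ominus>\<^bsub>R\<^esub> a) \<in> Units R"
        by blast
      then show ?thesis using that by (simp add: a_minus_def l_minus minus_add a_comm)
    qed
    show "perfectly_clean (T2 R)"
      unfolding perfectly_clean_def
    proof
      fix A assume "A \<in> carrier (T2 R)"
      then obtain a c d where A: "A = Mat2 a c \<zero>\<^bsub>R\<^esub> d"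
        and acd: "a \<in> carrier R" "c \<in> carrier R" "d \<in> carrier R" by (rule T2_cases)
      have clean: "\<exists>E\<in>comm2 (T2 R) A. E \<otimes>\<^bsub>T2 R\<^esub> E = E \<and> A \<ominus>\<^bsub>T2 R\<^esub> E \<in> Units (T2 R)"
        if "Mat2 e f \<zero>\<^bsub>R\<^esub> g \<in> comm2 (T2 R) A"
          "Mat2 e f \<zero>\<^bsub>R\<^esub> g \<otimes>\<^bsub>T2 R\<^esub> Mat2 e f \<zero>\<^bsub>R\<^esub> g = Mat2 e f \<zero>\<^bsub>R\<^esub> g"
          "a \<ominus>\<^bsub>R\<^esub> e \<in> Units R" "d \<ominus>\<^bsub>R\<^esub> g \<in> Units R" for e f g
      proof -
        have "e \<in> carrier R" "f \<in> carrier R" "g \<in> carrier R"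
          using that(1) by (auto simp: comm2_def T2_simps)
        then have "A \<ominus>\<^bsub>T2 R\<^esub> Mat2 e f \<zero>\<^bsub>R\<^esub> g \<in> Units (T2 R)"
          using that(3,4) acd unfolding A by (simp add: T2_minus T2_Units)
        then show ?thesis using that(1,2) by blast
      qed
      have central: "\<zero>\<^bsub>T2 R\<^esub> \<in> comm2 (T2 R) A" "\<one>\<^bsub>T2 R\<^esub> \<in> comm2 (T2 R) A"
        by (auto simp: comm2_def comm_def)
      note wb' = wb[unfolded local_ring_uniquely_weakly_bleached_iff[OF assms], rule_format]
      \<comment> \<open>If neither 0 nor 1 works, some diagonal entry is a non-unit and some entry
        minus 1 is a non-unit. By \<open>one_minus\<close> these are different entries, which leaves
        the last two cases.\<close>
      consider (zero) "a \<in> Units R" "d \<in> Units R"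
        | (one) "a \<ominus>\<^bsub>R\<^esub> \<one>\<^bsub>R\<^esub> \<in> Units R" "d \<ominus>\<^bsub>R\<^esub> \<one>\<^bsub>R\<^esub> \<in> Units R"
        | (upper) "a \<notin> Units R" "d \<ominus>\<^bsub>R\<^esub> \<one>\<^bsub>R\<^esub> \<notin> Units R"
        | (lower) "d \<notin> Units R" "a \<ominus>\<^bsub>R\<^esub> \<one>\<^bsub>R\<^esub> \<notin> Units R"
        using one_minus acd by blast
      then show "\<exists>E\<in>comm2 (T2 R) A. E \<otimes>\<^bsub>T2 R\<^esub> E = E \<and> A \<ominus>\<^bsub>T2 R\<^esub> E \<in> Units (T2 R)"
      proof cases
        case zero
        then show ?thesis
          using clean[of "\<zero>\<^bsub>R\<^esub>" "\<zero>\<^bsub>R\<^esub>" "\<zero>\<^bsub>R\<^esub>"] central(1) acd r0(1) by (simp add: T2_simps)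
      next
        case one
        then show ?thesis
          using clean[of "\<one>\<^bsub>R\<^esub>" "\<zero>\<^bsub>R\<^esub>" "\<one>\<^bsub>R\<^esub>"] central(2) by (simp add: T2_simps)
      next
        case upper
        \<comment> \<open>That d is a unit is the contrapositive of
          \<open>one_minus\<close>.\<close>
        then have "a \<ominus>\<^bsub>R\<^esub> \<one>\<^bsub>R\<^esub> \<in> Units R" "d \<ominus>\<^bsub>R\<^esub> \<zero>\<^bsub>R\<^esub> \<in> Units R"
          using one_minus acd r0(1) by auto
        moreover obtain f where "f \<in> carrier R" "?E f \<in> comm2 (T2 R) A"
          using wb'[of a d] upper acd A by blast
        ultimately show ?thesis
          using clean[of "\<one>\<^bsub>R\<^esub>" f "\<zero>\<^bsub>R\<^esub>"] by (simp add: T2_simps)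
      next
        case lower
        \<comment> \<open>The second of the two maps, with the roles of a and d exchanged, again
          gives diagonal (1, 0). Here a and d - 1 are units, so its complement is the idempotent
          that makes \<open>A\<close> clean.\<close>
        obtain f where f: "f \<in> carrier R" "?E f \<in> comm2 (T2 R) A"
          using wb'[of d a] lower acd A by blast
        have "a \<ominus>\<^bsub>R\<^esub> \<zero>\<^bsub>R\<^esub> \<in> Units R" "d \<ominus>\<^bsub>R\<^esub> \<one>\<^bsub>R\<^esub> \<in> Units R"
          using lower one_minus acd r0(1) by auto
        moreover have "Mat2 \<zero>\<^bsub>R\<^esub> (\<ominus>\<^bsub>R\<^esub> f) \<zero>\<^bsub>R\<^esub> \<one>\<^bsub>R\<^esub> \<in> comm2 (T2 R) A"
          using T.comm2_one_minus[OF f(2)] f(1) by (simp add: compl r0)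
        ultimately show ?thesis
          using clean[of "\<zero>\<^bsub>R\<^esub>" "\<ominus>\<^bsub>R\<^esub> f" "\<one>\<^bsub>R\<^esub>"] f(1) by (simp add: T2_simps)
      qed
    qed
  qed
qed

end
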